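(* Let $G$ be a bounded labeled acyclic digraph with source $\hat0$ and sink $\hat1$ which is balanced and satisfies the parity condition. Let the vertex set be partitioned as $V=S\sqcup T\sqcup\{\hat0,\hat1\}$. Then $$\widetilde f_{G_S}(-1)=(-1)^{\ell(G)-1}\cdot\widetilde f_{G_T}(-1).$$
   Context: A labeled acyclic digraph $G=(V,E)$ is a directed graph (multiple edges allowed) with no directed cycles, locally finite (finitely many directed paths between any two vertices), with a set $\Lambda$ carrying an arbitrary binary relation $\sim$ and a labeling $\lambda:E\to\Lambda$. A directed path of length $k$ from $x$ to $y$ is a sequence of edges $(e_1,\dots,e_k)$ with $\operatorname{tail}(e_1)=x$, $\operatorname{head}(e_k)=y$, $\operatorname{head}(e_i)=\operatorname{tail}(e_{i+1})$. Write $x\le y$ if there is a directed path from $x$ to $y$; the interval $[x,y]$ is $\{z: x\le z\le y\}$. $G$ is bounded if it has a unique source $\hat0$ and a unique sink $\hat1$. A path is rising if $\lambda(e_i)\sim\lambda(e_{i+1})$ for all $i\le k-1$ and falling if $\lambda(e_i)\not\sim\lambda(e_{i+1})$ for all $i\le k-1$. $G$ is balanced if for every interval $[x,y]$ and every $k\ge0$ the number of rising paths from $x$ to $y$ of length $k$ equals the number of falling ones. $\ell(G)$ is the length of the longest path in $G$; $G$ satisfies the parity condition if all paths from $\hat0$ to $\hat1$ have lengths of the same parity. For a bounded labeled digraph $H$, $\widetilde f_H(q)=\sum_p q^{\ell(p)-1}$ summed over all falling paths $p$ from $\hat0$ to $\hat1$ in $H$. For $S\subseteq V-\{\hat0,\hat1\}$,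 the restricted digraph $G_S$ has vertex set $S\cup\{\hat0,\hat1\}$, label set $\Lambda^+=\bigcup_{n\ge1}\Lambda^n$ with relation $(\lambda_1,\dots,\lambda_m)\sim(\mu_1,\dots,\mu_n)$ iff $\lambda_m\sim\mu_1$, and for every rising path $(e_1,\dots,e_k)$ in $G$ with $\operatorname{tail}(e_1),\operatorname{head}(e_k)\in S\cup\{\hat0,\hat1\}$ and none of the intermediate vertices $\operatorname{head}(e_1),\dots,\operatorname{head}(e_{k-1})$ in $S$, an edge of $G_S$ from $\operatorname{tail}(e_1)$ to $\operatorname{head}(e_k)$ with label $(\lambda(e_1),\dots,\lambda(e_k))$. *)

theory Defs
  imports "Graph_Theory.Graph_Theory" "HOL-Computational_Algebra.Polynomial"
begin

text \<open>
  Directed paths are the arc walks of Graph_Theory: \<open>pre_digraph.awalk D x p y\<close> says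
  that the list of arcs \<open>p\<close> leads from \<open>x\<close> to \<open>y\<close>. The empty list is the path of length 0.
\<close>

record ('v, 'e, 'l) labeled_digraph =
  dg :: "('v, 'e) pre_digraph"
  labels :: "'l set"
  lab :: "'e \<Rightarrow> 'l"
  label_rel :: "'l \<Rightarrow> 'l \<Rightarrow> bool"

abbreviation dpath :: "('v, 'e, 'l) labeled_digraph \<Rightarrow> 'v \<Rightarrow> 'e list \<Rightarrow> 'v \<Rightarrow> bool" where
  "dpath G \<equiv> pre_digraph.awalk (dg G)"

locale labeled_acyclic_digraph =
  fixes G :: "('v, 'e, 'l) labeled_digraph"
  assumes wf: "wf_digraph (dg G)"
    and lab_in_labels: "e \<in> arcs (dg G) \<Longrightarrow> lab G e \<in> labels G"
    and acyclic: "\<nexists>c. pre_digraph.cycle (dg G) c"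
    and locally_finite: "x \<in> verts (dg G) \<Longrightarrow> y \<in> verts (dg G) \<Longrightarrow> finite {p. dpath G x p y}"

definition bounded_digraph :: "('v, 'e, 'l) labeled_digraph \<Rightarrow> 'v \<Rightarrow> 'v \<Rightarrow> bool" where
  "bounded_digraph G s t \<longleftrightarrow>
     {v \<in> verts (dg G). in_arcs (dg G) v = {}} = {s} \<and>
     {v \<in> verts (dg G). out_arcs (dg G) v = {}} = {t}"

definition rising :: "('v, 'e, 'l) labeled_digraph \<Rightarrow> 'e list \<Rightarrow> bool" where
  "rising G p \<longleftrightarrow> successively (label_rel G) (map (lab G) p)"

definition falling :: "('v, 'e, 'l) labeled_digraph \<Rightarrow> 'e list \<Rightarrow> bool" where
  "falling G p \<longleftrightarrow> successively (\<lambda>a b. \<not> label_rel G a b) (map (lab G) p)"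

definition dle :: "('v, 'e, 'l) labeled_digraph \<Rightarrow> 'v \<Rightarrow> 'v \<Rightarrow> bool" where
  "dle G x y \<longleftrightarrow> (\<exists>p. dpath G x p y)"

definition balanced :: "('v, 'e, 'l) labeled_digraph \<Rightarrow> bool" where
  "balanced G \<longleftrightarrow> (\<forall>x y k. dle G x y \<longrightarrow>
     card {p. dpath G x p y \<and> length p = k \<and> rising G p} =
     card {p. dpath G x p y \<and> length p = k \<and> falling G p})"

definition path_lengths :: "('v, 'e, 'l) labeled_digraph \<Rightarrow> nat set" where
  "path_lengths G = {length p |p x y. dpath G x p y}"

text \<open>
  Meaningful only if \<open>path_lengths G\<close> is bounded above, that is, if a longest path exists.
\<close>
definition digraph_length :: "('v, 'e, 'l) labeled_digraph \<Rightarrow> nat" where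
  "digraph_length G = Max (path_lengths G)"

definition parity_condition :: "('v, 'e, 'l) labeled_digraph \<Rightarrow> 'v \<Rightarrow> 'v \<Rightarrow> bool" where
  "parity_condition G s t \<longleftrightarrow>
     (\<forall>p q. dpath G s p t \<longrightarrow> dpath G s q t \<longrightarrow> even (length p) = even (length q))"

text \<open>
  The source \<open>s\<close> and the sink \<open>t\<close> are arguments because a restricted digraph inherits them from
  the original digraph, but may have further sources and sinks: an element of \<open>S\<close> need not be
  the end of any arc of the restriction. The truncated subtraction differs from the subtraction
  of integers only if \<open>s = t\<close>, where the path of length 0 contributes \<open>1\<close>.
\<close>
definition f_tilde :: "('v, 'e, 'l) labeled_digraph \<Rightarrow> 'v \<Rightarrow> 'v \<Rightarrow> int poly" where
  "f_tilde H s t = (\<Sum>p | dpath H s p t \<and> falling H p. monom 1 (length p - 1))"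

text \<open>The arcs of the restricted digraph are the rising paths themselves.\<close>
definition restricted_digraph ::
  "('v, 'e, 'l) labeled_digraph \<Rightarrow> 'v \<Rightarrow> 'v \<Rightarrow> 'v set \<Rightarrow> ('v, 'e list, 'l list) labeled_digraph"
where
  "restricted_digraph G s t S =
     \<lparr> dg = \<lparr> verts = S \<union> {s, t},
              arcs = {p. p \<noteq> [] \<and> rising G p \<and>
                         (\<exists>x \<in> S \<union> {s, t}. \<exists>y \<in> S \<union> {s, t}. dpath G x p y) \<and>
                         (\<forall>e \<in> set (butlast p). head (dg G) e \<notin> S)},
              tail = (\<lambda>p. tail (dg G) (hd p)),
              head = (\<lambda>p. head (dg G) (last p)) \<rparr>,
       labels = {w. w \<noteq> [] \<and> set w \<subseteq> labels G},
       lab = map (lab G),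
       label_rel = (\<lambda>u w. label_rel G (last u) (hd w)) \<rparr>"

end

theory Submission
  imports Defs
begin

text \<open>
  Concatenation identifies the falling paths of \<open>G\<^sub>S\<close> with the paths of \<open>G\<close> from \<open>s\<close> to \<open>t\<close> whose
  descents occur exactly at the interior vertices in \<open>S\<close>, so the left-hand side is a sum over paths
  of products of local factors: \<open>[ascent]\<close> at vertices outside \<open>S\<close> and \<open>-[descent] = [ascent] - 1\<close> at
  vertices in \<open>S\<close>. Expanding the latter turns it into the sum over chains
  \<open>s < u\<^sub>1 < \<dots> < u\<^sub>k < t\<close> in \<open>S\<close> of \<open>(-1)\<^sup>k R(s, u\<^sub>1) \<cdots> R(u\<^sub>k, t)\<close>, where \<open>R\<close> counts nonempty rising
  paths. Since \<open>G\<close> is balanced, \<open>R\<close> may be replaced by the number of falling paths, so ascents and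
  descents may be exchanged. As \<open>T\<close> is the complement of \<open>S\<close> in the interior, the exchanged condition
  says that the descents occur exactly in \<open>T\<close>, and parity accounts for the sign.
\<close>

section \<open>Cutting lists into blocks\<close>

text \<open>
  A path of the restricted digraph, being a list of rising paths, is a path of the original digraph
  cut exactly at its interior vertices in \<open>S\<close>; here \<open>A\<close> is the set of arcs with head in \<open>S\<close>.
\<close>
fun cut_at :: "'e set \<Rightarrow> 'e list list \<Rightarrow> bool" where
  "cut_at A [] \<longleftrightarrow> True" |
  "cut_at A (b # bs) \<longleftrightarrow>
     b \<noteq> [] \<and> set (butlast b) \<inter> A = {} \<and> (bs \<noteq> [] \<longrightarrow> last b \<in> A) \<and> cut_at A bs"

lemma cut_at_not_Nil: "cut_at A bs \<Longrightarrow> b \<in> set bs \<Longrightarrow> b \<noteq> []"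
  by (induction bs) auto

lemma cut_at_concat_eq_Nil: "cut_at A bs \<Longrightarrow> concat bs = [] \<longleftrightarrow> bs = []"
  by (cases bs) auto

text \<open>If the first blocks differed, the last entry of the shorter one would lie in
  \<open>A\<close> and at the same time be a nonfinal entry of the longer one.\<close>

lemma cut_at_unique:
  "cut_at A bs \<Longrightarrow> cut_at A cs \<Longrightarrow> concat bs = concat cs \<Longrightarrow> bs = cs"
proof (induction bs arbitrary: cs)
  case Nil
  then show ?case by (metis concat.simps(1) cut_at_concat_eq_Nil)
next
  case (Cons b bs)
  then obtain c cs' where cs: "cs = c # cs'" by (cases cs) auto
  have no_overlap: "us = []"
    if "x = y @ us" "us @ concat xs = concat ys" "cut_at A (x # xs)" "cut_at A (y # ys)"
    for x y us :: "'a list" and xs ys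
  proof (rule ccontr)
    assume us: "us \<noteq> []"
    with that have "ys \<noteq> []" by auto
    with that have "last y \<in> A" "y \<noteq> []" by auto
    moreover from us that(1) have "butlast x = y @ butlast us" by (simp add: butlast_append)
    moreover from \<open>y \<noteq> []\<close> have "last y \<in> set y" by (rule last_in_set)
    ultimately show False using that(3) by (auto simp del: last_in_set)
  qed
  have "b @ concat bs = c @ concat cs'" using Cons.prems cs by simp
  then consider us where "b = c @ us" "us @ concat bs = concat cs'"
    | us where "c = b @ us" "us @ concat cs' = concat bs"
    by (auto simp: append_eq_append_conv2)
  then have "b = c \<and> concat bs = concat cs'"
    using Cons.prems cs no_overlap by cases (metis append_Nil append_Nil2)+
  with Cons cs show ?case by auto
qed

lemma cut_at_exists: "\<exists>bs. cut_at A bs \<and> concat bs = p"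
proof (induction p)
  case Nil
  show ?case by (rule exI[of _ "[]"]) simp
next
  case (Cons e p)
  then obtain bs where bs: "cut_at A bs" "concat bs = p" by blast
  show ?case
  \<comment> \<open>\<open>e\<close> forms a block of its own if a cut must follow it or nothing
    follows; otherwise it joins the first block.\<close>
  proof (cases "e \<in> A \<or> bs = []")
    case True
    with bs show ?thesis by (intro exI[of _ "[e] # bs"]) auto
  next
    case False
    then obtain c cs where "bs = c # cs" by (cases bs) auto
    with False bs show ?thesis by (intro exI[of _ "(e # c) # cs"]) auto
  qed
qed

text \<open>Each block but the final one contributes exactly one nonfinal entry in \<open>A\<close>,
  namely its last. This turns the exponent in \<open>f_tilde\<close> into a count along the
  concatenated path.\<close>

lemma cut_at_length:
  "cut_at A bs \<Longrightarrow> length bs - 1 = length (filter (\<lambda>e. e \<in> A) (butlast (concat bs)))"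
proof (induction bs)
  case (Cons b bs)
  have b: "filter (\<lambda>e. e \<in> A) (butlast b) = []"
    using Cons.prems by (auto simp: filter_empty_conv)
  show ?case
  proof (cases "bs = []")
    case False
    then have "concat bs \<noteq> []" using Cons.prems cut_at_concat_eq_Nil[of A bs] by simp
    moreover have "filter (\<lambda>e. e \<in> A) b = [last b]"
    proof -
      have "filter (\<lambda>e. e \<in> A) b = filter (\<lambda>e. e \<in> A) (butlast b @ [last b])"
        using Cons.prems by simp
      also have "\<dots> = [last b]"
        using False Cons.prems b by (simp del: append_butlast_last_id)
      finally show ?thesis .
    qed
    moreover obtain n where "length bs = Suc n" using False by (cases bs) auto
    ultimately show ?thesis using False Cons by (auto simp: butlast_append)
  qed (use b in simp)
qed simp

text \<open>Inside a block \<open>e\<close> is outside \<open>A\<close>, so the condition reads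
  \<open>P e e'\<close>; across a boundary \<open>e\<close> ends its block, hence lies in
  \<open>A\<close>, and the condition reads \<open>\<not> P e e'\<close>.\<close>

lemma successively_cut_at:
  "cut_at A bs \<Longrightarrow>
   successively (\<lambda>e e'. e \<in> A \<longleftrightarrow> \<not> P e e') (concat bs) \<longleftrightarrow>
   (\<forall>b\<in>set bs. successively P b) \<and> successively (\<lambda>b c. \<not> P (last b) (hd c)) bs"
proof (induction bs)
  case (Cons b bs)
  have *: "successively (\<lambda>e e'. e \<in> A \<longleftrightarrow> \<not> P e e') c \<longleftrightarrow> successively P c"
    if "set (butlast c) \<inter> A = {}" for c
    using that by (induction c rule: induct_list012) auto
  then have b: "successively (\<lambda>e e'. e \<in> A \<longleftrightarrow> \<not> P e e') b \<longleftrightarrow> successively P b"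
    using Cons.prems by auto
  show ?case
  proof (cases bs)
    case Nil
    with b show ?thesis by simp
  next
    case (Cons c cs)
    with Cons.IH Cons.prems b show ?thesis by (auto simp: successively_append_iff)
  qed
qed simp

section \<open>Signed weights of paths\<close>

text \<open>The weight vanishes unless \<open>A\<close> marks exactly the nonfinal entries at which
  \<open>P\<close> fails; the sign counts these. The final entry is left out because a path has no
  ascent or descent at its end.\<close>

definition signed_weight :: "'e set \<Rightarrow> ('e \<Rightarrow> 'e \<Rightarrow> bool) \<Rightarrow> 'e list \<Rightarrow> int" where
  "signed_weight A P p =
     (if successively (\<lambda>e e'. e \<in> A \<longleftrightarrow> \<not> P e e') p
      then (-1) ^ length (filter (\<lambda>e. e \<in> A) (butlast p)) else 0)"

lemma signed_weight_Cons_Cons: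
  "signed_weight A P (e # e' # p) =
     (of_bool (P e e') - of_bool (e \<in> A)) * signed_weight A P (e' # p)"
  by (auto simp: signed_weight_def)

text \<open>
  \<open>signed_weight A P p\<close> is the product of the factors \<open>of_bool (P e e') - of_bool (e \<in> A)\<close> over
  consecutive \<open>e\<close>, \<open>e'\<close>. Multiplying out, the terms are grouped by the first position \<open>k\<close> at
  which the second summand is taken.
\<close>
lemma signed_weight_rec:
  assumes "p \<noteq> []"
  shows "signed_weight A P p = of_bool (successively P p) -
    (\<Sum>k = 1..<length p. if last (take k p) \<in> A \<and> successively P (take k p)
                         then signed_weight A P (drop k p) else 0)"
  using assms
proof (induction p rule: induct_list012)
  case (3 e e' p)
  let ?g = "\<lambda>p k. if last (take k p) \<in> A \<and> successively P (take k p)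
                         then signed_weight A P (drop k p) else 0"
  \<comment> \<open>The term \<open>k = 1\<close> cuts right after \<open>e\<close>; every later cut
    keeps both \<open>e\<close> and \<open>e'\<close> in the prefix and so carries the factor
    \<open>of_bool (P e e')\<close>.\<close>
  have "(\<Sum>k = 1..<length (e # e' # p). ?g (e # e' # p) k) =
     ?g (e # e' # p) 1 + (\<Sum>k = Suc 1..<Suc (length (e' # p)). ?g (e # e' # p) k)"
    by (subst sum.atLeast_Suc_lessThan) auto
  also have "(\<Sum>k = Suc 1..<Suc (length (e' # p)). ?g (e # e' # p) k) =
     (\<Sum>k = 1..<length (e' # p). ?g (e # e' # p) (Suc k))"
    by (rule sum.shift_bounds_Suc_ivl)
  also have "\<dots> = (\<Sum>k = 1..<length (e' # p). of_bool (P e e') * ?g (e' # p) k)"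
  proof (rule sum.cong)
    fix k assume "k \<in> {1..<length (e' # p)}"
    then obtain j where "k = Suc j" by (cases k) auto
    then show "?g (e # e' # p) (Suc k) = of_bool (P e e') * ?g (e' # p) k" by simp
  qed simp
  also have "\<dots> = of_bool (P e e') * (\<Sum>k = 1..<length (e' # p). ?g (e' # p) k)"
    by (rule sum_distrib_left[symmetric])
  also have "\<dots> = of_bool (P e e') * (of_bool (successively P (e' # p)) - signed_weight A P (e' # p))"
    using "3.IH"(2) by simp
  finally show ?case
    by (auto simp: signed_weight_Cons_Cons)
qed (auto simp: signed_weight_def)

sublocale labeled_acyclic_digraph \<subseteq> wf_digraph "dg G"
  by (rule wf)

section \<open>Weight sums over paths, and the exchange of ascents and descents\<close>

context labeled_acyclic_digraph
begin

abbreviation arc_rel :: "'e \<Rightarrow> 'e \<Rightarrow> bool" where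
  "arc_rel e e' \<equiv> label_rel G (lab G e) (lab G e')"

abbreviation arcs_into :: "'v set \<Rightarrow> 'e set" where
  "arcs_into S \<equiv> {e. head (dg G) e \<in> S}"

lemma finite_awalks: "finite {p. awalk x p y}"
proof (cases "x \<in> verts (dg G) \<and> y \<in> verts (dg G)")
  case True
  then show ?thesis using locally_finite by blast
next
  case False
  then have "{p. awalk x p y} = {}" using awalk_hd_in_verts awalk_last_in_verts by blast
  then show ?thesis by (simp only: finite.emptyI)
qed

lemma finite_awalks_conj: "finite {p. awalk x p y \<and> P p}"
  using finite_awalks by (rule finite_subset[rotated]) auto

lemma awalk_tail_hd: "awalk x p y \<Longrightarrow> p \<noteq> [] \<Longrightarrow> tail (dg G) (hd p) = x"
  by (cases p) (auto simp: awalk_Cons_iff)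

lemma awalk_head_last: "awalk x p y \<Longrightarrow> p \<noteq> [] \<Longrightarrow> head (dg G) (last p) = y"
  by (induction p arbitrary: x) (auto simp: awalk_Cons_iff awalk_Nil_iff)

lemma awalk_appendE:
  assumes "awalk x (a @ b) y"
  obtains z where "awalk x a z" "awalk z b y"
  using assms by auto

text \<open>Cutting after \<open>k\<close> arcs matches the paths that contribute with triples of
  cut vertex, prefix and suffix. As \<open>0 < k\<close>, the cut vertex can be read off the last
  arc of the prefix. The summand depends on the suffix alone, so prefixes are merely
  counted.\<close>

lemma sum_awalks_split:
  fixes g :: "'e list \<Rightarrow> int"
  assumes "0 < k" "k \<le> n" "finite S"
  shows "(\<Sum>p | awalk x p y \<and> length p = n.
            if last (take k p) \<in> arcs_into S \<and> P (take k p) then g (drop k p) else 0) =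
         (\<Sum>u\<in>S. int (card {a. awalk x a u \<and> length a = k \<and> P a}) *
            (\<Sum>b | awalk u b y \<and> length b = n - k. g b))"
proof -
  let ?A = "\<lambda>u. {a. awalk x a u \<and> length a = k \<and> P a}"
  let ?B = "\<lambda>u. {b. awalk u b y \<and> length b = n - k}"
  let ?C = "SIGMA u:S. ?A u \<times> ?B u"
  let ?L = "{p \<in> {p. awalk x p y \<and> length p = n}.
              last (take k p) \<in> arcs_into S \<and> P (take k p)}"
  have "(\<Sum>p | awalk x p y \<and> length p = n.
            if last (take k p) \<in> arcs_into S \<and> P (take k p) then g (drop k p) else 0) =
        (\<Sum>p\<in>?L. g (drop k p))"
    by (rule sum.inter_filter[symmetric]) (rule finite_awalks_conj)
  also have "\<dots> = (\<Sum>(u, a, b)\<in>?C. g b)"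
  proof (rule sum.reindex_bij_witness[where i = "\<lambda>(u, a, b). a @ b"
        and j = "\<lambda>p. (head (dg G) (last (take k p)), take k p, drop k p)"])
    fix p assume p: "p \<in> ?L"
    then have "awalk x (take k p @ drop k p) y" by simp
    then obtain z where z: "awalk x (take k p) z" "awalk z (drop k p) y" by (rule awalk_appendE)
    moreover have "take k p \<noteq> []" using p assms by auto
    ultimately have "head (dg G) (last (take k p)) = z" using awalk_head_last by blast
    with p z assms show "(head (dg G) (last (take k p)), take k p, drop k p) \<in> ?C" by auto
  next
    fix c assume "c \<in> ?C"
    then obtain u a b where c: "c = (u, a, b)" "u \<in> S" "awalk x a u" "length a = k" "P a"
      "awalk u b y" "length b = n - k" by auto
    moreover have "head (dg G) (last a) = u" using c assms by (intro awalk_head_last) auto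
    ultimately show "(\<lambda>(u, a, b). a @ b) c \<in> ?L"
      "(head (dg G) (last (take k ((\<lambda>(u, a, b). a @ b) c))), take k ((\<lambda>(u, a, b). a @ b) c),
        drop k ((\<lambda>(u, a, b). a @ b) c)) = c"
      using assms by (auto intro: awalk_appendI)
  qed auto
  also have "\<dots> = (\<Sum>u\<in>S. \<Sum>(a, b)\<in>?A u \<times> ?B u. g b)"
    using assms by (subst sum.Sigma) (auto intro: finite_awalks_conj)
  also have "\<dots> = (\<Sum>u\<in>S. int (card (?A u)) * (\<Sum>b\<in>?B u. g b))"
    by (simp add: sum.cartesian_product[symmetric])
  finally show ?thesis .
qed

text \<open>On the right-hand side \<open>P\<close> enters only through numbers of paths of fixed
  length and through the same sum for shorter paths, which is the form in which balance can be
  applied.\<close>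

lemma sum_signed_weight_rec:
  assumes "0 < n" "finite S"
  shows "(\<Sum>p | awalk x p y \<and> length p = n. signed_weight (arcs_into S) P p) =
    int (card {p. awalk x p y \<and> length p = n \<and> successively P p}) -
    (\<Sum>k = 1..<n. \<Sum>u\<in>S. int (card {a. awalk x a u \<and> length a = k \<and> successively P a}) *
       (\<Sum>b | awalk u b y \<and> length b = n - k. signed_weight (arcs_into S) P b))"
proof -
  let ?N = "{p. awalk x p y \<and> length p = n}"
  let ?g = "\<lambda>p k. if last (take k p) \<in> arcs_into S \<and> successively P (take k p)
                  then signed_weight (arcs_into S) P (drop k p) else 0"
  have "(\<Sum>p\<in>?N. signed_weight (arcs_into S) P p) =
        (\<Sum>p\<in>?N. of_bool (successively P p) - (\<Sum>k = 1..<n. ?g p k))"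
    using assms by (intro sum.cong refl) (subst signed_weight_rec, auto)
  also have "\<dots> = (\<Sum>p\<in>?N. of_bool (successively P p)) - (\<Sum>k = 1..<n. \<Sum>p\<in>?N. ?g p k)"
    by (simp add: sum_subtractf sum.swap[of _ ?N])
  also have "(\<Sum>p\<in>?N. of_bool (successively P p)) =
      int (card {p. awalk x p y \<and> length p = n \<and> successively P p})"
    by (subst sum_of_bool_eq) (auto intro: finite_awalks_conj simp: Int_def conj_assoc)
  also have "(\<Sum>k = 1..<n. \<Sum>p\<in>?N. ?g p k) =
    (\<Sum>k = 1..<n. \<Sum>u\<in>S. int (card {a. awalk x a u \<and> length a = k \<and> successively P a}) *
       (\<Sum>b | awalk u b y \<and> length b = n - k. signed_weight (arcs_into S) P b))"
    using assms by (intro sum.cong refl sum_awalks_split) auto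
  finally show ?thesis .
qed

lemma balanced_card_eq:
  assumes "balanced G"
  shows "card {p. awalk x p y \<and> length p = k \<and> successively arc_rel p} =
         card {p. awalk x p y \<and> length p = k \<and> successively (\<lambda>e e'. \<not> arc_rel e e') p}"
proof (cases "dle G x y")
  case True
  then show ?thesis
    using assms by (auto simp: balanced_def rising_def falling_def successively_map)
next
  case False
  then have "\<not> awalk x p y" for p by (auto simp: dle_def)
  then show ?thesis by simp
qed

text \<open>In the recursion balance replaces each number of rising prefixes by that of falling
  ones, and the suffixes have length \<open>n - k < n\<close>. The start vertex varies because
  suffixes begin at \<open>u\<close>.\<close>

lemma balanced_sum_signed_weight_length:
  assumes "balanced G" "finite S"
  shows "(\<Sum>p | awalk x p y \<and> length p = n. signed_weight (arcs_into S) arc_rel p) =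
    (\<Sum>p | awalk x p y \<and> length p = n. signed_weight (arcs_into S) (\<lambda>e e'. \<not> arc_rel e e') p)"
proof (induction n arbitrary: x rule: less_induct)
  case (less n)
  show ?case
  proof (cases "n = 0")
    case True
    \<comment> \<open>At most the empty path occurs, and its weight is 1 under both
      relations.\<close>
    then show ?thesis by (intro sum.cong) (auto simp: signed_weight_def)
  next
    case False
    have "(\<Sum>k = 1..<n. \<Sum>u\<in>S. int (card {a. awalk x a u \<and> length a = k \<and> successively arc_rel a}) *
       (\<Sum>b | awalk u b y \<and> length b = n - k. signed_weight (arcs_into S) arc_rel b)) =
       (\<Sum>k = 1..<n. \<Sum>u\<in>S.
         int (card {a. awalk x a u \<and> length a = k \<and> successively (\<lambda>e e'. \<not> arc_rel e e') a}) *
         (\<Sum>b | awalk u b y \<and> length b = n - k.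
            signed_weight (arcs_into S) (\<lambda>e e'. \<not> arc_rel e e') b))"
      by (intro sum.cong refl arg_cong2[where f = "(*)"] less)
        (simp_all only: balanced_card_eq[OF assms(1)], auto)
    with False assms show ?thesis
      by (simp only: sum_signed_weight_rec balanced_card_eq[OF assms(1)] neq0_conv)
  qed
qed

lemma balanced_sum_signed_weight:
  assumes "balanced G" "finite S"
  shows "(\<Sum>p | awalk x p y. signed_weight (arcs_into S) arc_rel p) =
    (\<Sum>p | awalk x p y. signed_weight (arcs_into S) (\<lambda>e e'. \<not> arc_rel e e') p)"
proof -
  have "(\<Sum>p | awalk x p y. f p) =
        (\<Sum>n\<in>length ` {p. awalk x p y}. \<Sum>p | awalk x p y \<and> length p = n. f p)"
    for f :: "'e list \<Rightarrow> int"
    using sum.group[OF finite_awalks[of x y] finite_imageI[OF finite_awalks[of x y], of length]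
        order_refl, of f] by simp
  then show ?thesis by (simp only: balanced_sum_signed_weight_length[OF assms])
qed

end

section \<open>Bounded digraphs and their restrictions\<close>

locale bounded_labeled_digraph = labeled_acyclic_digraph G
  for G :: "('v, 'e, 'l) labeled_digraph" +
  fixes s t :: 'v
  assumes bounded: "bounded_digraph G s t"
    and bdd_lengths: "bdd_above (path_lengths G)"

context bounded_labeled_digraph
begin

lemma source_in_verts: "s \<in> verts (dg G)" and sink_in_verts: "t \<in> verts (dg G)"
  using bounded by (auto simp: bounded_digraph_def)

lemma head_neq_source: "e \<in> arcs (dg G) \<Longrightarrow> head (dg G) e \<noteq> s"
  using bounded by (auto simp: bounded_digraph_def in_arcs_def)

lemma tail_neq_sink: "e \<in> arcs (dg G) \<Longrightarrow> tail (dg G) e \<noteq> t"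
  using bounded by (auto simp: bounded_digraph_def out_arcs_def)

lemma sourceI: "v \<in> verts (dg G) \<Longrightarrow> in_arcs (dg G) v = {} \<Longrightarrow> v = s"
  and sinkI: "v \<in> verts (dg G) \<Longrightarrow> out_arcs (dg G) v = {} \<Longrightarrow> v = t"
  using bounded by (auto simp: bounded_digraph_def)

lemma finite_path_lengths: "finite (path_lengths G)"
  using bdd_lengths by (simp add: bdd_above_nat)

text \<open>\<open>Q\<close> serves to fix one endpoint: a longest path with that endpoint cannot be
  prolonged at the other.\<close>

lemma longest_awalk:
  assumes "\<exists>x p y. Q x p y \<and> awalk x p y"
  obtains x p y where "Q x p y" "awalk x p y"
    "\<forall>x' p' y'. Q x' p' y' \<longrightarrow> awalk x' p' y' \<longrightarrow> length p' \<le> length p"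
proof -
  let ?L = "{length p |x p y. Q x p y \<and> awalk x p y}"
  have fin: "finite ?L"
    by (rule finite_subset[OF _ finite_path_lengths]) (auto simp: path_lengths_def)
  moreover have "?L \<noteq> {}" using assms by blast
  ultimately have "Max ?L \<in> ?L" by (rule Max_in)
  then obtain x p y where "Q x p y" "awalk x p y" "Max ?L = length p" by blast
  moreover have "length p' \<le> Max ?L" if "Q x' p' y'" "awalk x' p' y'" for x' p' y'
    using fin that by (intro Max_ge) auto
  ultimately show ?thesis using that by metis
qed

text \<open>A longest path ending at \<open>v\<close> cannot be prolonged backwards, so it starts at
  a vertex without incoming arcs, which is \<open>s\<close>.\<close>

lemma awalk_from_source:
  assumes "v \<in> verts (dg G)"
  shows "\<exists>p. awalk s p v"
proof -
  have "\<exists>x p y. y = v \<and> awalk x p y" using assms awalk_Nil_iff by blast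
  then obtain x p y where p: "y = v" "awalk x p y"
    "\<forall>x' p' y'. y' = v \<longrightarrow> awalk x' p' y' \<longrightarrow> length p' \<le> length p"
    by (rule longest_awalk) blast
  have "in_arcs (dg G) x = {}"
  proof (rule ccontr)
    assume "in_arcs (dg G) x \<noteq> {}"
    then obtain e where "e \<in> arcs (dg G)" "head (dg G) e = x"
      by (metis ex_in_conv in_in_arcs_conv)
    with p have "awalk (tail (dg G) e) (e # p) v" by (simp add: awalk_Cons_iff)
    then have "length (e # p) \<le> length p" using p(3) by blast
    then show False by simp
  qed
  with p show ?thesis using sourceI awalk_hd_in_verts by blast
qed

lemma awalk_to_sink:
  assumes "v \<in> verts (dg G)"
  shows "\<exists>p. awalk v p t"
proof -
  have "\<exists>x p y. x = v \<and> awalk x p y" using assms awalk_Nil_iff by blast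
  then obtain x p y where p: "x = v" "awalk x p y"
    "\<forall>x' p' y'. x' = v \<longrightarrow> awalk x' p' y' \<longrightarrow> length p' \<le> length p"
    by (rule longest_awalk) blast
  have "out_arcs (dg G) y = {}"
  proof (rule ccontr)
    assume "out_arcs (dg G) y \<noteq> {}"
    then obtain e where "e \<in> arcs (dg G)" "tail (dg G) e = y"
      by (metis ex_in_conv in_out_arcs_conv)
    then have "awalk y [e] (head (dg G) e)" using arc_implies_awalk by blast
    with p have "awalk v (p @ [e]) (head (dg G) e)" by (auto intro: awalk_appendI)
    then have "length (p @ [e]) \<le> length p" using p(3) by blast
    then show False by simp
  qed
  with p show ?thesis using sinkI awalk_last_in_verts by blast
qed

text \<open>Every vertex lies on a path from \<open>s\<close> to \<open>t\<close>, and by local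
  finiteness there are finitely many of these.\<close>

lemma finite_verts: "finite (verts (dg G))"
proof (rule finite_subset)
  show "verts (dg G) \<subseteq> (\<Union>p\<in>{p. awalk s p t}. set (awalk_verts s p))"
  proof
    fix v assume "v \<in> verts (dg G)"
    then obtain p q where pq: "awalk s p v" "awalk v q t"
      using awalk_from_source awalk_to_sink by blast
    then have "awalk s (p @ q) t" by (rule awalk_appendI)
    moreover have "v \<in> set (awalk_verts s (p @ q))"
      using set_awalk_verts_append[OF pq] hd_in_awalk_verts(1)[OF pq(2)] by blast
    ultimately show "v \<in> (\<Union>p\<in>{p. awalk s p t}. set (awalk_verts s p))" by blast
  qed
qed (use finite_awalks in simp)

text \<open>No arc leaves \<open>t\<close>, so for \<open>s = t\<close> only the empty path remains.
  This isolates the case in which \<open>length p - 1\<close> is truncated.\<close>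

lemma awalk_Nil_iff_source_sink: "awalk s p t \<Longrightarrow> p = [] \<longleftrightarrow> s = t"
  by (cases p) (auto simp: awalk_Nil_iff awalk_Cons_iff tail_neq_sink)

text \<open>A path of maximal length extends to one from \<open>s\<close> to \<open>t\<close>. The
  parity condition, which concerns only such paths, thereby applies to
  \<open>digraph_length G\<close>.\<close>

lemma longest_path_source_sink: "\<exists>p. awalk s p t \<and> length p = digraph_length G"
proof -
  have "path_lengths G \<noteq> {}"
    using awalk_to_sink[OF source_in_verts] by (auto simp: path_lengths_def)
  then have "digraph_length G \<in> path_lengths G"
    unfolding digraph_length_def using finite_path_lengths by (intro Max_in)
  then obtain x p y where p: "awalk x p y" "length p = digraph_length G"
    by (auto simp: path_lengths_def)
  obtain a b where ab: "awalk s a x" "awalk y b t"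
    using p awalk_from_source awalk_to_sink awalk_hd_in_verts awalk_last_in_verts by meson
  with p have apb: "awalk s (a @ p @ b) t" by (auto intro!: awalk_appendI)
  then have "length (a @ p @ b) \<in> path_lengths G" unfolding path_lengths_def by blast
  then have "length (a @ p @ b) \<le> digraph_length G"
    unfolding digraph_length_def using finite_path_lengths by (intro Max_ge)
  with p apb show ?thesis by (intro exI[of _ "a @ p @ b"]) auto
qed

text \<open>A nonfinal arc is followed by another, so its head has both an incoming and an outgoing
  arc.\<close>

lemma head_interior:
  assumes "awalk x p y" "e \<in> set (butlast p)"
  shows "head (dg G) e \<in> verts (dg G) - {s, t}"
proof -
  obtain a b where ab: "butlast p = a @ e # b" using split_list[OF assms(2)] by blast
  have "p \<noteq> []" using assms(2) by auto
  then have "p = a @ e # b @ [last p]" using append_butlast_last_id[of p] ab by simp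
  then obtain e' c where "p = a @ e # e' # c" by (cases b) auto
  with assms(1) show ?thesis
    by (auto simp: awalk_Cons_iff head_neq_source tail_neq_sink)
       (metis head_neq_source)
qed

section \<open>Paths and polynomial of the restricted digraph\<close>

text \<open>Consecutive arcs of the restriction meet at an interior vertex of the concatenated path.
  It is neither \<open>s\<close> nor \<open>t\<close>, hence in \<open>S\<close>, so the cuts fall
  exactly at the visits to \<open>S\<close>.\<close>

lemma dpath_restricted_iff:
  assumes "S \<subseteq> verts (dg G)" "x \<in> S \<union> {s, t}" "y \<in> S \<union> {s, t}"
  shows "dpath (restricted_digraph G s t S) x bs y \<longleftrightarrow>
    cut_at (arcs_into S) bs \<and> awalk x (concat bs) y \<and> (\<forall>b\<in>set bs. rising G b)"
  using assms(2)
proof (induction bs arbitrary: x)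
  case Nil
  then show ?case using assms source_in_verts sink_in_verts
    by (auto simp: pre_digraph.awalk_def pre_digraph.cas.simps restricted_digraph_def)
next
  case (Cons b bs)
  let ?V = "S \<union> {s, t}"
  let ?H = "restricted_digraph G s t S"
  let ?z = "head (dg G) (last b)"
  have arc: "b \<in> arcs (dg ?H) \<longleftrightarrow> b \<noteq> [] \<and> rising G b \<and> (\<exists>x\<in>?V. \<exists>y\<in>?V. awalk x b y) \<and>
      set (butlast b) \<inter> arcs_into S = {}"
    by (auto simp: restricted_digraph_def)
  have H: "verts (dg ?H) = ?V" "tail (dg ?H) b = tail (dg G) (hd b)" "head (dg ?H) b = ?z"
    by (simp_all add: restricted_digraph_def)
  \<comment> \<open>\<open>awalk\<close> requires its start to be a vertex of the digraph, so
    \<open>bs\<close> can be a path from \<open>?z\<close> only if \<open>?z\<close> lies in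
    \<open>?V\<close>.\<close>
  have step: "dpath ?H x (b # bs) y \<longleftrightarrow>
      b \<in> arcs (dg ?H) \<and> tail (dg G) (hd b) = x \<and> dpath ?H ?z bs y"
    if "?z \<in> ?V"
    using that Cons.prems
    unfolding pre_digraph.awalk_def pre_digraph.cas.simps H list.set insert_subset by blast
  show ?case
  proof
    assume L: "dpath ?H x (b # bs) y"
    then have "b \<in> arcs (dg ?H)" "tail (dg G) (hd b) = x"
      unfolding pre_digraph.awalk_def pre_digraph.cas.simps H list.set insert_subset by blast+
    then have b: "b \<noteq> []" "rising G b" "set (butlast b) \<inter> arcs_into S = {}"
      "awalk x b ?z" "?z \<in> ?V"
      unfolding arc using awalk_tail_hd awalk_head_last by metis+
    then have bs: "cut_at (arcs_into S) bs" "awalk ?z (concat bs) y" "\<forall>c\<in>set bs. rising G c"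
      using L step Cons.IH[of ?z] by auto
    have "last b \<in> arcs_into S" if "bs \<noteq> []"
    proof -
      have "concat bs \<noteq> []" using bs(1) that cut_at_concat_eq_Nil by blast
      then have "?z \<noteq> t" using bs(2) tail_neq_sink
        by (cases "concat bs") (auto simp: awalk_Cons_iff)
      moreover have "last b \<in> arcs (dg G)" using b(1,4) last_in_set by blast
      ultimately show ?thesis using b(5) head_neq_source by auto
    qed
    with b bs show "cut_at (arcs_into S) (b # bs) \<and> awalk x (concat (b # bs)) y \<and>
        (\<forall>b\<in>set (b # bs). rising G b)"
      by (auto intro: awalk_appendI)
  next
    assume R: "cut_at (arcs_into S) (b # bs) \<and> awalk x (concat (b # bs)) y \<and>
        (\<forall>b\<in>set (b # bs). rising G b)"
    then have "awalk x (b @ concat bs) y" by simp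
    then obtain z where z: "awalk x b z" "awalk z (concat bs) y" by (rule awalk_appendE)
    have "b \<noteq> []" using R by simp
    with z have hb: "?z = z" "tail (dg G) (hd b) = x"
      using awalk_head_last awalk_tail_hd by auto
    have "z \<in> ?V"
    proof (cases "bs = []")
      case True
      with z have "z = y" by (auto simp: awalk_Nil_iff)
      then show ?thesis using assms by simp
    next
      case False
      with R hb show ?thesis by auto
    qed
    with R z hb Cons \<open>b \<noteq> []\<close> show "dpath ?H x (b # bs) y"
      by (subst step) (auto simp: arc)
  qed
qed

text \<open>Concatenation is a bijection from the falling paths of the restriction onto the paths of
  \<open>G\<close> with nonzero weight, and it preserves the sign.\<close>

lemma poly_f_tilde_restricted:
  assumes "S \<subseteq> verts (dg G)"
  shows "poly (f_tilde (restricted_digraph G s t S) s t) (-1) =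
         (\<Sum>p | awalk s p t. signed_weight (arcs_into S) arc_rel p)"
proof -
  let ?H = "restricted_digraph G s t S"
  define A where "A = arcs_into S"
  let ?Q = "{bs. dpath ?H s bs t \<and> falling ?H bs}"
  let ?P = "{p. awalk s p t \<and> successively (\<lambda>e e'. e \<in> A \<longleftrightarrow> \<not> arc_rel e e') p}"
  have Q: "bs \<in> ?Q \<longleftrightarrow> cut_at A bs \<and> concat bs \<in> ?P" for bs
  proof -
    have d: "dpath ?H s bs t \<longleftrightarrow>
        cut_at A bs \<and> awalk s (concat bs) t \<and> (\<forall>b\<in>set bs. successively arc_rel b)"
      using dpath_restricted_iff[OF assms, of s t bs]
      unfolding A_def rising_def successively_map by simp
    show ?thesis
    proof (cases "cut_at A bs")
      case True
      \<comment> \<open>Blocks are nonempty, so the last and first labels of a block are the labels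
        of its last and first arcs.\<close>
      have "falling ?H bs \<longleftrightarrow> successively (\<lambda>b c. \<not> arc_rel (last b) (hd c)) bs"
        unfolding falling_def successively_map
        using cut_at_not_Nil[OF True]
        by (intro successively_cong) (auto simp: restricted_digraph_def last_map hd_map)
      then show ?thesis
        using successively_cut_at[OF True, of arc_rel] True d by simp
    qed (simp add: d)
  qed
  have "bij_betw concat ?Q ?P"
  proof (rule bij_betw_imageI)
    show "inj_on concat ?Q" by (intro inj_onI cut_at_unique) (use Q in blast)+
    show "concat ` ?Q = ?P"
    proof
      show "?P \<subseteq> concat ` ?Q" using Q cut_at_exists by (metis (no_types, lifting) image_eqI subsetI)
    qed (use Q in blast)
  qed
  have "poly (f_tilde ?H s t) (-1) = (\<Sum>bs\<in>?Q. (-1) ^ (length bs - 1))"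
    by (simp add: f_tilde_def poly_sum poly_monom)
  also have "\<dots> = (\<Sum>bs\<in>?Q. (-1) ^ length (filter (\<lambda>e. e \<in> A) (butlast (concat bs))))"
    by (intro sum.cong refl arg_cong[where f = "power (- 1)"] cut_at_length) (use Q in blast)
  also have "\<dots> = (\<Sum>p\<in>?P. (-1) ^ length (filter (\<lambda>e. e \<in> A) (butlast p)))"
    by (rule sum.reindex_bij_betw[OF \<open>bij_betw concat ?Q ?P\<close>])
  also have "\<dots> = (\<Sum>p\<in>{p. awalk s p t}. signed_weight A arc_rel p)"
    by (rule sum.mono_neutral_cong_left[OF finite_awalks]) (auto simp: signed_weight_def)
  finally show ?thesis by (simp only: A_def)
qed

end

section \<open>Passing from \<open>S\<close> to its complement \<open>T\<close>\<close>

text \<open>Agreement is asked only at nonfinal entries, since \<open>S\<close> and \<open>T\<close>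
  are complementary only among interior vertices.\<close>

lemma successively_cong_butlast:
  assumes "\<And>e e'. e \<in> set (butlast p) \<Longrightarrow> P e e' \<longleftrightarrow> Q e e'"
  shows "successively P p \<longleftrightarrow> successively Q p"
  using assms by (induction p rule: induct_list012) auto

theorem theorem5p1:
  fixes G :: "('v, 'e, 'l) labeled_digraph" and s t :: 'v and S T :: "'v set"
  assumes "labeled_acyclic_digraph G"
    and "bounded_digraph G s t"
    and "bdd_above (path_lengths G)"
    and "balanced G"
    and "parity_condition G s t"
    and "verts (dg G) = S \<union> T \<union> {s, t}"
    and "S \<inter> T = {}"
    and "s \<notin> S \<union> T" and "t \<notin> S \<union> T"
  shows "poly (f_tilde (restricted_digraph G s t S) s t) (-1) =
         (-1) ^ (digraph_length G - 1) * poly (f_tilde (restricted_digraph G s t T) s t) (-1)"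
proof -
  interpret bounded_labeled_digraph G s t
    by (intro bounded_labeled_digraph.intro bounded_labeled_digraph_axioms.intro assms(1-3))
  have ST: "S \<subseteq> verts (dg G)" "T \<subseteq> verts (dg G)" using assms(6) by auto
  then have "finite S" using finite_verts finite_subset by blast
  obtain p0 where p0: "awalk s p0 t" "length p0 = digraph_length G"
    using longest_path_source_sink by blast
  \<comment> \<open>Ascents exactly in \<open>S\<close> means descents exactly in \<open>T\<close>,
    so both weights have the same support. Their signs multiply to
    \<open>(-1) ^ (length p - 1)\<close>, as each nonfinal arc enters \<open>S\<close> or
    \<open>T\<close>.\<close>
  have weight: "signed_weight (arcs_into S) (\<lambda>e e'. \<not> arc_rel e e') p =
      (-1) ^ (digraph_length G - 1) * signed_weight (arcs_into T) arc_rel p"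
    if p: "awalk s p t" for p
  proof -
    have interior: "e \<in> arcs_into T \<longleftrightarrow> e \<notin> arcs_into S" if "e \<in> set (butlast p)" for e
      using head_interior[OF p that] assms(6-9) by auto
    let ?n = "\<lambda>S. length (filter (\<lambda>e. e \<in> arcs_into S) (butlast p))"
    have "?n T = length (filter (\<lambda>e. e \<notin> arcs_into S) (butlast p))"
      using interior by (intro arg_cong[where f = length] filter_cong) auto
    then have n: "length p - 1 = ?n S + ?n T"
      using sum_length_filter_compl[of "\<lambda>e. e \<in> arcs_into S" "butlast p"] by simp
    have "even (length p) = even (digraph_length G)"
      using p p0 assms(5) unfolding parity_condition_def by metis
    \<comment> \<open>Equal parity survives the truncated subtraction of 1 only if both lengths
      vanish together.\<close>
    moreover have "length p = 0 \<longleftrightarrow> digraph_length G = 0"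
      using awalk_Nil_iff_source_sink[OF p] awalk_Nil_iff_source_sink[OF p0(1)] p0(2) by auto
    ultimately have "even (length p - 1) = even (digraph_length G - 1)"
      by (cases "length p"; cases "digraph_length G") auto
    then have "(-1 :: int) ^ (digraph_length G - 1) = (-1) ^ ?n S * (-1) ^ ?n T"
      unfolding n power_add[symmetric] by (simp add: minus_one_power_iff)
    moreover have "successively (\<lambda>e e'. e \<in> arcs_into S \<longleftrightarrow> \<not> \<not> arc_rel e e') p \<longleftrightarrow>
        successively (\<lambda>e e'. e \<in> arcs_into T \<longleftrightarrow> \<not> arc_rel e e') p"
      by (rule successively_cong_butlast) (use interior in blast)
    ultimately show ?thesis
      unfolding signed_weight_def by (simp add: mult.assoc power_mult_distrib[symmetric])
  qed
  show ?thesis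
    using weight
    by (simp add: poly_f_tilde_restricted ST balanced_sum_signed_weight assms(4) \<open>finite S\<close>
        sum_distrib_left)
qed

end
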